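(* Let $n\ge 1$, let $M=\{1^{k_1},2^{k_2},\ldots,n^{k_n}\}$ be a multiset with $k_i\ge 1$ for all $i$, and let $K=k_1+k_2+\cdots+k_n$. Then $$C_M(x,y,z)=\sum_{i=0}^{K-n} z^i\sum_{j=1}^{\lfloor (K+1-i)/2\rfloor}\gamma_{M,i,j}\,(xy)^j(x+y)^{K+1-i-2j},$$ where $\gamma_{M,i,j}$ is the number of canonical Gessel trees on $M$ with $i$ $z$-leaves and $j$ $y$-leaves.
   Context: Here $i^{k_i}$ means $k_i$ occurrences of $i$. A permutation $\sigma=\sigma_1\sigma_2\cdots\sigma_K$ of the multiset $M$ is a Stirling permutation if whenever $\sigma_a=\sigma_b$ with $a<b$, one has $\sigma_c\ge\sigma_a$ for all $a<c<b$. $Q_M$ is the set of Stirling permutations of $M$. Convention: $\sigma_0=\sigma_{K+1}=0$. An index $1\le i\le K$ is an ascent if $\sigma_{i-1}<\sigma_i$, a descent if $\sigma_i>\sigma_{i+1}$, and a plateau if $\sigma_i=\sigma_{i+1}$; their numbers are $\mathrm{asc}(\sigma),\mathrm{des}(\sigma),\mathrm{plat}(\sigma)$. Define $$C_M(x,y,z)=\sum_{\sigma\in Q_M}x^{\mathrm{asc}(\sigma)}y^{\mathrm{des}(\sigma)}z^{\mathrm{plat}(\sigma)}.$$ A Gessel tree on $M$ is a rooted plane tree whose internal vertices are labeled by $1,2,\ldots,n$ (each used exactly once), whose external vertices (leaves) are unlabeled, such that internal vertex $i$ has exactly $k_i+1$ (linearly ordered) children and the labels of internal vertices increase along every path from the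 root. A leaf is an $x$-leaf if it is the first (leftmost) child of its parent, a $y$-leaf if it is the last child of its parent, and a $z$-leaf otherwise. A $y$-leaf is balanced if its parent also has an $x$-leaf, and unbalanced otherwise. A Gessel tree is canonical if no internal vertex has an unbalanced $y$-leaf. *)

theory Defs
  imports Complex_Main "HOL-Library.Multiset"
begin

definition stirling_perms :: "nat multiset \<Rightarrow> nat list set" where
  "stirling_perms M = {\<sigma>. mset \<sigma> = M \<and>
     (\<forall>a c b. a < c \<and> c < b \<and> b < length \<sigma> \<and> \<sigma> ! a = \<sigma> ! b \<longrightarrow> \<sigma> ! c \<ge> \<sigma> ! a)}"

text \<open>With the boundary convention of a zero at both ends, \<open>padded \<sigma> ! i\<close> is the
  \<open>i\<close>-th letter of \<open>\<sigma>\<close> in 1-based indexing, also for \<open>i = 0\<close> and \<open>i = length \<sigma> + 1\<close>.\<close>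

definition padded :: "nat list \<Rightarrow> nat list" where
  "padded \<sigma> = 0 # \<sigma> @ [0]"

definition asc :: "nat list \<Rightarrow> nat" where
  "asc \<sigma> = card {i \<in> {1..length \<sigma>}. padded \<sigma> ! (i - 1) < padded \<sigma> ! i}"

definition des :: "nat list \<Rightarrow> nat" where
  "des \<sigma> = card {i \<in> {1..length \<sigma>}. padded \<sigma> ! i > padded \<sigma> ! (i + 1)}"

definition plat :: "nat list \<Rightarrow> nat" where
  "plat \<sigma> = card {i \<in> {1..length \<sigma>}. padded \<sigma> ! i = padded \<sigma> ! (i + 1)}"

text \<open>The trivariate polynomial is given by its values at the elements \<open>x\<close>, \<open>y\<close>, \<open>z\<close> of an
  arbitrary commutative semiring; an identity that holds for all such values is the same as an
  identity of polynomials, since the semiring may itself be a polynomial ring.\<close>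

definition stirling_poly :: "nat multiset \<Rightarrow> 'a \<Rightarrow> 'a \<Rightarrow> 'a \<Rightarrow> 'a :: comm_semiring_1" where
  "stirling_poly M x y z = (\<Sum>\<sigma>\<in>stirling_perms M. x ^ asc \<sigma> * y ^ des \<sigma> * z ^ plat \<sigma>)"

datatype ptree = Leaf | Node nat "ptree list"

text \<open>The internal vertices in preorder, each given by its label and its list of children.\<close>

primrec vertices :: "ptree \<Rightarrow> (nat \<times> ptree list) list" where
  "vertices Leaf = []"
| "vertices (Node a ts) = (a, ts) # concat (map vertices ts)"

definition gessel_tree :: "nat multiset \<Rightarrow> ptree \<Rightarrow> bool" where
  "gessel_tree M t \<longleftrightarrow>
     distinct (map fst (vertices t)) \<and>
     set (map fst (vertices t)) = set_mset M \<and>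
     (\<forall>(a, ts) \<in> set (vertices t). length ts = count M a + 1) \<and>
     (\<forall>(a, ts) \<in> set (vertices t). \<forall>b us. Node b us \<in> set ts \<longrightarrow> a < b)"

text \<open>A leaf that has a parent is represented by the list \<open>ts\<close> of its parent's children and
  its position \<open>p\<close> in that list.\<close>

definition leaves :: "ptree \<Rightarrow> (ptree list \<times> nat) list" where
  "leaves t = [(ts, p). (a, ts) \<leftarrow> vertices t, p \<leftarrow> [0..<length ts], ts ! p = Leaf]"

definition x_leaf :: "ptree list \<times> nat \<Rightarrow> bool" where
  "x_leaf = (\<lambda>(ts, p). p = 0)"

definition y_leaf :: "ptree list \<times> nat \<Rightarrow> bool" where
  "y_leaf = (\<lambda>(ts, p). p + 1 = length ts)"

definition z_leaf :: "ptree list \<times> nat \<Rightarrow> bool" where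
  "z_leaf l \<longleftrightarrow> \<not> x_leaf l \<and> \<not> y_leaf l"

definition y_leaves :: "ptree \<Rightarrow> nat" where
  "y_leaves t = length (filter y_leaf (leaves t))"

definition z_leaves :: "ptree \<Rightarrow> nat" where
  "z_leaves t = length (filter z_leaf (leaves t))"

definition balanced :: "ptree list \<times> nat \<Rightarrow> bool" where
  "balanced = (\<lambda>(ts, p). \<exists>q < length ts. ts ! q = Leaf \<and> x_leaf (ts, q))"

definition canonical :: "ptree \<Rightarrow> bool" where
  "canonical t \<longleftrightarrow> (\<forall>l \<in> set (leaves t). y_leaf l \<longrightarrow> balanced l)"

definition gamma_coeff :: "nat multiset \<Rightarrow> nat \<Rightarrow> nat \<Rightarrow> nat" where
  "gamma_coeff M i j =
     card {t. gessel_tree M t \<and> canonical t \<and> z_leaves t = i \<and> y_leaves t = j}"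

end

theory Submission imports Defs begin

text \<open>Cutting a Stirling permutation at all occurrences of its least letter \<open>a\<close> gives words
  \<open>w\<^sub>0, \<dots>, w\<^sub>k\<close>, which share no letter: an \<open>a\<close> between two equal larger letters is forbidden.
  Making \<open>a\<close> a vertex whose children are the trees of the \<open>w\<^sub>i\<close> is Gessel's bijection; its
  inverse, \<open>word\<close>, joins the words of the children with the label of their parent
  (\<open>bij_betw_word\<close>). Each adjacent pair of letters in the padded permutation corresponds to one leaf,
  and an ascent, descent or plateau corresponds to a first, last or middle child, because the two
  neighbours of an empty word are its parent label \<open>a\<close> and either \<open>a\<close> again or a smaller letter.
  So \<open>C\<^sub>M(x, y, z)\<close> is the sum over Gessel trees of the product over all leaves of \<open>x\<close>, \<open>y\<close> or
  \<open>z\<close> (\<open>stirling_poly_conv_trees\<close>).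

  In that sum, a vertex with exactly one leaf among its first and last child has a partner: the
  vertex with these two children exchanged, which has the leaf at the other end. The map \<open>canon\<close>
  moves every such leaf to the front; its values are the canonical trees. The trees that
  \<open>canon\<close> sends to a given canonical tree arise by an independent choice between the two versions
  at every vertex whose first child is a leaf and whose last child is not. Each of these vertices
  contributes \<open>x + y\<close> to the sum over the fibre, each vertex with leaves at both ends contributes
  \<open>x y\<close>, and each middle leaf contributes \<open>z\<close> (\<open>sum_fibre_canon\<close>).

  A canonical tree with \<open>i\<close> middle leaves and \<open>j\<close> last leaves has \<open>j\<close> vertices of the second
  kind. As there are \<open>K + 1\<close> leaves in all, it has \<open>K + 1 - i - 2 j\<close> of the first kind, so its
  fibre has weight \<open>z^i * (x y)^j * (x + y)^(K + 1 - i - 2 j)\<close>. Summing over the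
  canonical trees by the values of \<open>i\<close> and \<open>j\<close> gives the theorem.\<close>

section \<open>Increasing trees and their words\<close>

definition labels :: "ptree \<Rightarrow> nat list" where
  "labels t = map fst (vertices t)"

lemma labels_simps [simp]:
  "labels Leaf = []"
  "labels (Node a ts) = a # concat (map labels ts)"
  by (simp_all add: labels_def[abs_def] map_concat o_def)

lemma two_ends: "2 \<le> length ts \<Longrightarrow> \<exists>s us e. ts = s # us @ [e]"
  by (cases ts; cases "tl ts" rule: rev_cases) auto

text \<open>For every \<open>M\<close>, the Gessel trees on \<open>M\<close> are increasing; what distinguishes the different \<open>M\<close> is
  the multiset of letters of the word (\<open>gessel_tree_iff\<close>). The multiset passes to subtrees only
  after restriction to their labels, so inductions run over this predicate instead.\<close>

inductive increasing :: "ptree \<Rightarrow> bool" where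
  increasing_Leaf: "increasing Leaf"
| increasing_Node: "2 \<le> length ts \<Longrightarrow> (\<And>t. t \<in> set ts \<Longrightarrow> increasing t) \<Longrightarrow>
    (\<And>t b. t \<in> set ts \<Longrightarrow> b \<in> set (labels t) \<Longrightarrow> a < b) \<Longrightarrow>
    distinct (concat (map labels ts)) \<Longrightarrow> increasing (Node a ts)"

primrec join :: "nat \<Rightarrow> nat list list \<Rightarrow> nat list" where
  "join a [] = []"
| "join a (w # ws) = w @ (if ws = [] then [] else a # join a ws)"

primrec word :: "ptree \<Rightarrow> nat list" where
  "word Leaf = []"
| "word (Node a ts) = join a (map word ts)"

lemma mset_join: "mset (join a ws) = replicate_mset (length ws - 1) a + mset (concat ws)"
proof (induction ws)
  case (Cons w ws)
  then show ?case by (cases ws) auto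
qed simp

text \<open>A vertex with \<open>k + 1\<close> children puts \<open>k\<close> copies of its label between their words.\<close>

lemma mset_word:
  "mset (word t) = (\<Sum>(a, ts)\<leftarrow>vertices t. replicate_mset (length ts - 1) a)"
proof (induction t)
  case (Node a ts)
  have "mset (concat (map word us)) =
      (\<Sum>(a, ts)\<leftarrow>concat (map vertices us). replicate_mset (length ts - 1) a)"
    if "set us \<subseteq> set ts" for us
    using that by (induction us) (auto simp: Node.IH)
  from this[of ts] show ?case by (simp add: mset_join)
qed simp

lemma count_word:
  assumes "distinct (labels t)" "(a, ts) \<in> set (vertices t)"
  shows "count (mset (word t)) a = length ts - 1"
proof -
  have "count (\<Sum>(b, us)\<leftarrow>xs. replicate_mset (length us - 1) b) a =
      (if a \<in> set (map fst xs) then length ts - 1 else 0)"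
    if "distinct (map fst xs)" "\<And>us. (a, us) \<in> set xs \<Longrightarrow> us = ts"
    for xs :: "(nat \<times> ptree list) list"
    using that by (induction xs) (force simp: split: if_splits)+
  moreover have "us = ts" if "(a, us) \<in> set (vertices t)" for us
    using assms that eq_key_imp_eq_value unfolding labels_def by metis
  moreover have "a \<in> set (map fst (vertices t))"
    using assms(2) by force
  ultimately show ?thesis
    using assms(1) unfolding mset_word labels_def by presburger
qed

lemma set_word:
  assumes "\<And>a ts. (a, ts) \<in> set (vertices t) \<Longrightarrow> 2 \<le> length ts"
  shows "set (word t) = set (labels t)"
proof -
  have "set_mset (\<Sum>(b, us)\<leftarrow>xs. replicate_mset (length us - 1) b) = set (map fst xs)"
    if "\<And>a ts. (a, ts) \<in> set xs \<Longrightarrow> 2 \<le> length ts"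
    for xs :: "(nat \<times> ptree list) list"
    using that
  proof (induction xs)
    case (Cons p xs)
    obtain a ts where p: "p = (a, ts)" by force
    then have "2 \<le> length ts" using Cons.prems[of a ts] by simp
    moreover have "set_mset (\<Sum>(b, us)\<leftarrow>xs. replicate_mset (length us - 1) b) = set (map fst xs)"
      by (rule Cons.IH) (meson Cons.prems list.set_intros(2))
    ultimately show ?case
      by (simp add: p del: set_mset_sum_list)
  qed simp
  with assms show ?thesis
    by (metis mset_word labels_def set_mset_mset)
qed

lemma increasing_length:
  "increasing t \<Longrightarrow> (a, ts) \<in> set (vertices t) \<Longrightarrow> 2 \<le> length ts"
  by (induction rule: increasing.induct) auto

lemma increasing_local:
  "increasing t \<Longrightarrow> (a, ts) \<in> set (vertices t) \<Longrightarrow> Node b us \<in> set ts \<Longrightarrow> a < b"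
proof (induction arbitrary: b us rule: increasing.induct)
  case (increasing_Node us' c)
  show ?case
  proof (cases "(a, ts) = (c, us')")
    case True
    then show ?thesis
      using increasing_Node.prems increasing_Node.hyps(3)[of "Node b us" b] by simp
  next
    case False
    then show ?thesis
      using increasing_Node.prems increasing_Node.IH by auto
  qed
qed simp

lemma increasing_distinct: "increasing t \<Longrightarrow> distinct (labels t)"
  by (induction rule: increasing.induct) auto

text \<open>The local condition on labels compares a vertex only with its children; along a path it
  propagates to all descendants.\<close>

lemma increasingI:
  assumes "\<And>a ts. (a, ts) \<in> set (vertices t) \<Longrightarrow> 2 \<le> length ts"
    and "\<And>a ts b us. (a, ts) \<in> set (vertices t) \<Longrightarrow> Node b us \<in> set ts \<Longrightarrow> a < b"
    and "distinct (labels t)"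
  shows "increasing t"
  using assms
proof (induction t)
  case Leaf
  show ?case by (rule increasing_Leaf)
next
  case (Node a ts)
  have sub: "increasing t" if "t \<in> set ts" for t
  proof (rule Node.IH[OF that])
    show "distinct (labels t)"
      using Node.prems(3) that by (auto simp: distinct_concat_iff)
    show "2 \<le> length us" if "(b, us) \<in> set (vertices t)" for b us
      using Node.prems(1)[of b us] that \<open>t \<in> set ts\<close> by auto
    show "b < c" if "(b, us) \<in> set (vertices t)" "Node c vs \<in> set us" for b us c vs
      using Node.prems(2)[of b us c vs] that \<open>t \<in> set ts\<close> by auto
  qed
  have "a < b" if t: "t \<in> set ts" and b: "b \<in> set (labels t)" for t b
  proof (cases t)
    case (Node c us)
    have "a < c"
      using Node.prems(2)[of a ts c us] t Node by simp
    moreover have "c \<le> b"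
      using sub[OF t] b unfolding Node by (cases rule: increasing.cases) force+
    ultimately show ?thesis by simp
  qed (use b in simp)
  then show ?case
    using Node.prems sub by (intro increasing_Node) auto
qed

lemma gessel_tree_iff: "gessel_tree M t \<longleftrightarrow> increasing t \<and> mset (word t) = M"
proof
  assume g: "gessel_tree M t"
  then have d: "distinct (labels t)" and s: "set (labels t) = set_mset M"
    and l: "\<And>a ts. (a, ts) \<in> set (vertices t) \<Longrightarrow> length ts = count M a + 1"
    and i: "\<And>a ts b us. (a, ts) \<in> set (vertices t) \<Longrightarrow> Node b us \<in> set ts \<Longrightarrow> a < b"
    by (fastforce simp: gessel_tree_def labels_def)+
  have two: "2 \<le> length ts" if "(a, ts) \<in> set (vertices t)" for a ts
  proof -
    have "a \<in># M" using that s by (force simp: labels_def)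
    then show ?thesis using l[OF that] by simp
  qed
  have "count (mset (word t)) a = count M a" for a
  proof (cases "a \<in> set (labels t)")
    case True
    then obtain ts where ts: "(a, ts) \<in> set (vertices t)"
      by (auto simp: labels_def)
    show ?thesis using count_word[OF d ts] l[OF ts] by simp
  next
    case False
    then have "a \<notin> set (word t)" "a \<notin># M"
      using set_word[of t] two s by auto
    then show ?thesis
      by (metis count_eq_zero_iff set_mset_mset)
  qed
  then have "mset (word t) = M" by (rule multiset_eqI)
  moreover have "increasing t" by (intro increasingI two i d)
  ultimately show "increasing t \<and> mset (word t) = M" by simp
next
  assume "increasing t \<and> mset (word t) = M"
  then have inc: "increasing t" and M: "mset (word t) = M" by auto
  have two: "2 \<le> length ts" if "(a, ts) \<in> set (vertices t)" for a ts
    using increasing_length[OF inc that] .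
  have "set (labels t) = set_mset M"
    using set_word[of t] two M by auto
  moreover have "length ts = count M a + 1" if "(a, ts) \<in> set (vertices t)" for a ts
    using count_word[OF increasing_distinct[OF inc] that] two[OF that] M by simp
  ultimately show "gessel_tree M t"
    using increasing_local[OF inc] increasing_distinct[OF inc]
    by (fastforce simp: gessel_tree_def labels_def)
qed

section \<open>Stirling permutations as words of increasing trees\<close>

definition stirling :: "nat list \<Rightarrow> bool" where
  "stirling \<sigma> \<longleftrightarrow>
     (\<forall>a c b. a < c \<and> c < b \<and> b < length \<sigma> \<and> \<sigma> ! a = \<sigma> ! b \<longrightarrow> \<sigma> ! c \<ge> \<sigma> ! a)"

text \<open>Two equal letters on different sides of a smaller letter \<open>m\<close> violate the Stirling condition,
  which is why the two sides must have disjoint letters. Conversely, a pair that involves \<open>m\<close>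
  itself can only enclose letters that are at least \<open>m\<close>.\<close>

lemma stirling_append_iff:
  assumes u: "\<And>p. p \<in> set u \<Longrightarrow> m < p" and v: "\<And>p. p \<in> set v \<Longrightarrow> m \<le> p"
  shows "stirling (u @ m # v) \<longleftrightarrow> stirling u \<and> stirling v \<and> set u \<inter> set v = {}"
proof (intro iffI conjI)
  assume s: "stirling (u @ m # v)"
  note sD = s[unfolded stirling_def, rule_format]
  show "stirling u"
    unfolding stirling_def
  proof (intro allI impI)
    fix a c b :: nat assume "a < c \<and> c < b \<and> b < length u \<and> u ! a = u ! b"
    then show "u ! a \<le> u ! c"
      using sD[of a c b] by (simp add: nth_append)
  qed
  show "stirling v"
    unfolding stirling_def
  proof (intro allI impI)
    fix a c b :: nat assume "a < c \<and> c < b \<and> b < length v \<and> v ! a = v ! b"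
    then show "v ! a \<le> v ! c"
      using sD[of "length u + Suc a" "length u + Suc c" "length u + Suc b"]
      by (simp add: nth_append)
  qed
  show "set u \<inter> set v = {}"
  proof (rule ccontr)
    assume "set u \<inter> set v \<noteq> {}"
    then obtain p where p: "p \<in> set u" "p \<in> set v" by blast
    then obtain i j where "i < length u" "u ! i = p" "j < length v" "v ! j = p"
      by (auto simp: in_set_conv_nth)
    then have "p \<le> m"
      using sD[of i "length u" "length u + Suc j"] by (simp add: nth_append)
    then show False using u[OF p(1)] by simp
  qed
next
  assume "stirling u \<and> stirling v \<and> set u \<inter> set v = {}"
  then have su: "stirling u" and sv: "stirling v" and disj: "set u \<inter> set v = {}" by auto
  let ?\<sigma> = "u @ m # v" and ?l = "length u"
  show "stirling ?\<sigma>"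
    unfolding stirling_def
  proof (intro allI impI)
    fix a c b assume h: "a < c \<and> c < b \<and> b < length ?\<sigma> \<and> ?\<sigma> ! a = ?\<sigma> ! b"
    then have "?\<sigma> ! c \<in> set ?\<sigma>" by (intro nth_mem) simp
    then have mc: "m \<le> ?\<sigma> ! c" using u v by fastforce
    consider "b < ?l" | "?l < a" | "a = ?l" | "a < ?l" "b = ?l" | "a < ?l" "?l < b"
      by linarith
    then show "?\<sigma> ! a \<le> ?\<sigma> ! c"
    proof cases
      case 1
      then show ?thesis
        using h su[unfolded stirling_def, rule_format, of a c b]
        by (auto simp: nth_append split: if_splits)
    next
      case 2
      then show ?thesis
        using h sv[unfolded stirling_def, rule_format,
            of "a - Suc ?l" "c - Suc ?l" "b - Suc ?l"]
        by (auto simp: nth_append nth_Cons' diff_less_mono)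
    next
      case 3
      then show ?thesis using mc by simp
    next
      case 4
      then show ?thesis using h u[of "u ! a"] by (auto simp: nth_append split: if_splits)
    next
      case 5
      then have "?\<sigma> ! a = u ! a" "?\<sigma> ! b = v ! (b - Suc ?l)" "b - Suc ?l < length v"
        using h by (auto simp: nth_append nth_Cons')
      then have "?\<sigma> ! a \<in> set u" "?\<sigma> ! b \<in> set v"
        using 5 nth_mem by metis+
      then show ?thesis using h disj by auto
    qed
  qed
qed

lemma set_join: "set (join m ws) = \<Union> (set ` set ws) \<union> (if length ws \<le> 1 then {} else {m})"
  by (induction ws) (auto simp: Suc_le_eq)

lemma stirling_join_iff:
  assumes "\<And>w p. w \<in> set ws \<Longrightarrow> p \<in> set w \<Longrightarrow> m < p"
  shows "stirling (join m ws) \<longleftrightarrow>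
    (\<forall>w\<in>set ws. stirling w) \<and> sorted_wrt (\<lambda>u v. set u \<inter> set v = {}) ws"
  using assms
proof (induction ws)
  case Nil
  show ?case by (simp add: stirling_def)
next
  case (Cons w ws)
  show ?case
  proof (cases "ws = []")
    case False
    have "m \<le> p" if p: "p \<in> set (join m ws)" for p
    proof (cases "p = m")
      case False
      then obtain w' where "w' \<in> set ws" "p \<in> set w'"
        using p by (auto simp: set_join split: if_splits)
      then show ?thesis using Cons.prems[of w' p] by simp
    qed simp
    moreover have "m < p" if "p \<in> set w" for p
      using Cons.prems[of w p] that by simp
    ultimately have "stirling (join m (w # ws)) \<longleftrightarrow>
        stirling w \<and> stirling (join m ws) \<and> set w \<inter> set (join m ws) = {}"
      using False stirling_append_iff[of w m "join m ws"] by simp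
    moreover have "set w \<inter> set (join m ws) = {} \<longleftrightarrow> (\<forall>v\<in>set ws. set w \<inter> set v = {})"
    proof -
      have "m \<notin> set w" using Cons.prems[of w m] by auto
      then show ?thesis by (auto simp: set_join)
    qed
    moreover have "stirling (join m ws) \<longleftrightarrow>
        (\<forall>w\<in>set ws. stirling w) \<and> sorted_wrt (\<lambda>u v. set u \<inter> set v = {}) ws"
      using Cons.prems by (intro Cons.IH) auto
    ultimately show ?thesis by auto
  qed simp
qed

text \<open>The separators can be recognised in the joined word, since they do not occur in the pieces.\<close>

lemma join_inject:
  assumes "join a ws = join a ws'" "ws \<noteq> []" "ws' \<noteq> []"
    "\<forall>w\<in>set ws. a \<notin> set w" "\<forall>w\<in>set ws'. a \<notin> set w"
  shows "ws = ws'"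
  using assms
proof (induction ws arbitrary: ws')
  case (Cons w ws)
  obtain v vs where ws': "ws' = v # vs" using Cons.prems(3) by (cases ws') auto
  show ?case
  proof (cases "ws = [] \<or> vs = []")
    case True
    then show ?thesis using Cons.prems by (auto simp: ws' split: if_splits)
  next
    case False
    then have "w @ a # join a ws = v @ a # join a vs"
      using Cons.prems(1) by (simp add: ws')
    then have "w = v \<and> join a ws = join a vs"
      using Cons.prems(4,5) append_Cons_eq_iff[of a w "join a ws" v "join a vs"]
      by (auto simp: ws' append_eq_append_conv2 append_eq_Cons_conv Cons_eq_append_conv)
    then show ?thesis
      using Cons.IH[of vs] Cons.prems False by (simp add: ws')
  qed
qed simp

lemma join_exists: "\<exists>ws. ws \<noteq> [] \<and> (\<forall>w\<in>set ws. a \<notin> set w) \<and> join a ws = \<sigma>"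
proof (induction \<sigma> rule: length_induct)
  case (1 \<sigma>)
  show ?case
  proof (cases "a \<in> set \<sigma>")
    case False
    then show ?thesis by (intro exI[of _ "[\<sigma>]"]) simp
  next
    case True
    then obtain u v where \<sigma>: "\<sigma> = u @ a # v" "a \<notin> set u"
      by (meson split_list_first)
    then obtain ws where "ws \<noteq> []" "\<forall>w\<in>set ws. a \<notin> set w" "join a ws = v"
      using 1[rule_format, of v] by auto
    then show ?thesis using \<sigma> by (intro exI[of _ "u # ws"]) auto
  qed
qed

lemma increasing_set_word: "increasing t \<Longrightarrow> set (word t) = set (labels t)"
  by (metis set_word increasing_length)

lemma distinct_concat_labels_iff:
  "distinct (concat (map labels ts)) \<longleftrightarrow> (\<forall>t\<in>set ts. distinct (labels t)) \<and>
     sorted_wrt (\<lambda>s t. set (labels s) \<inter> set (labels t) = {}) ts"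
  by (induction ts) auto

lemma sorted_wrt_disjoint_words:
  assumes "\<And>t. t \<in> set ts \<Longrightarrow> increasing t"
  shows "sorted_wrt (\<lambda>u v. set u \<inter> set v = {}) (map word ts) \<longleftrightarrow>
    sorted_wrt (\<lambda>s t. set (labels s) \<inter> set (labels t) = {}) ts"
  using assms by (induction ts) (simp_all add: increasing_set_word)

lemma stirling_word: "increasing t \<Longrightarrow> stirling (word t)"
proof (induction rule: increasing.induct)
  case (increasing_Node ts a)
  have "a < p" if "w \<in> set (map word ts)" "p \<in> set w" for w p
    using that increasing_Node by (auto simp: increasing_set_word)
  then have "stirling (join a (map word ts)) \<longleftrightarrow> (\<forall>w\<in>set (map word ts). stirling w) \<and>
      sorted_wrt (\<lambda>u v. set u \<inter> set v = {}) (map word ts)"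
    by (rule stirling_join_iff)
  then show ?case
    using increasing_Node sorted_wrt_disjoint_words[of ts]
    by (simp add: distinct_concat_labels_iff)
qed (simp add: stirling_def)

lemma word_eq_Nil_iff: "increasing t \<Longrightarrow> word t = [] \<longleftrightarrow> t = Leaf"
  by (metis increasing_set_word labels_simps list.distinct(1) ptree.exhaust set_empty)

lemma Min_word_Node:
  assumes "increasing (Node a ts)"
  shows "Min (set (word (Node a ts))) = a"
  using assms unfolding increasing_set_word[OF assms]
  by (cases rule: increasing.cases) (force intro!: Min_eqI)

text \<open>The root label is the least letter of the word, and the words of the children are the pieces
  between its occurrences.\<close>

lemma word_inject: "increasing s \<Longrightarrow> increasing t \<Longrightarrow> word s = word t \<Longrightarrow> s = t"
proof (induction s arbitrary: t)
  case Leaf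
  then show ?case using word_eq_Nil_iff[of t] by simp
next
  case (Node a ss)
  then obtain b ts where t: "t = Node b ts"
    using word_eq_Nil_iff[of "Node a ss"] by (cases t) auto
  have ba: "b = a"
    using Min_word_Node Node.prems unfolding t by metis
  note inc = Node.prems(1) Node.prems(2)[unfolded t ba]
  have *: "2 \<le> length us \<and> (\<forall>u\<in>set us. increasing u \<and> a \<notin> set (word u))"
    if "increasing (Node a us)" for us
    using that by (cases rule: increasing.cases) (auto simp: increasing_set_word)
  have "map word ss = map word ts"
  proof (rule join_inject)
    show "join a (map word ss) = join a (map word ts)"
      using Node.prems(3) by (simp add: t ba)
  qed (use *[OF inc(1)] *[OF inc(2)] in auto)
  then have "ss = ts"
    using Node.IH *[OF inc(1)] *[OF inc(2)]
    by (smt (verit) in_set_conv_nth length_map nth_equalityI nth_map)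
  then show ?case by (simp add: t ba)
qed

text \<open>Split at the least letter and recurse: the pieces are shorter Stirling words with disjoint letters
  (\<open>stirling_join_iff\<close>), so the trees found for them have disjoint labels and fit under one root.\<close>

lemma word_surj: "stirling \<sigma> \<Longrightarrow> \<exists>t. increasing t \<and> word t = \<sigma>"
proof (induction \<sigma> rule: length_induct)
  case (1 \<sigma>)
  show ?case
  proof (cases "\<sigma> = []")
    case True
    then show ?thesis by (intro exI[of _ Leaf]) (simp add: increasing_Leaf)
  next
    case False
    define m where "m = Min (set \<sigma>)"
    obtain ws where ws: "ws \<noteq> []" "\<forall>w\<in>set ws. m \<notin> set w" "join m ws = \<sigma>"
      using join_exists by blast
    have m: "m \<in> set \<sigma>" and le: "\<And>p. p \<in> set \<sigma> \<Longrightarrow> m \<le> p"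
      using False by (auto simp: m_def)
    have len: "2 \<le> length ws"
    proof (rule ccontr)
      assume "\<not> 2 \<le> length ws"
      then obtain w where "ws = [w]" using ws(1) by (cases ws; cases "tl ws") auto
      then show False using ws m by auto
    qed
    have gt: "m < p" if "w \<in> set ws" "p \<in> set w" for w p
          proof -
      have "p \<in> set \<sigma>" using that by (auto simp: set_join simp flip: ws(3))
      then show ?thesis using le[of p] ws(2) that by (metis le_neq_implies_less)
    qed
    have st: "\<forall>w\<in>set ws. stirling w" "sorted_wrt (\<lambda>u v. set u \<inter> set v = {}) ws"
      using stirling_join_iff[of ws m] gt "1.prems" ws(3) by auto
    have "\<exists>t. increasing t \<and> word t = w" if w: "w \<in> set ws" for w
    proof -
      have "size (mset w) \<le> size (mset (concat ws))"
        using w by (intro size_mset_mono) (auto simp: mset_concat member_le_sum_list in_set_conv_decomp)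
      also have "\<dots> < size (mset \<sigma>)"
        using len by (simp add: mset_join flip: ws(3) size_mset)
      finally show ?thesis using 1 st(1) w by simp
    qed
    then obtain f where f: "\<And>w. w \<in> set ws \<Longrightarrow> increasing (f w) \<and> word (f w) = w"
      by metis
    let ?ts = "map f ws"
    have w: "map word ?ts = ws" using f by (simp add: map_idI)
    have lab: "set (labels (f w)) = set w" if "w \<in> set ws" for w
      using f[OF that] increasing_set_word by metis
    have "increasing (Node m ?ts)"
    proof (rule increasing_Node)
      show "distinct (concat (map labels ?ts))"
        unfolding distinct_concat_labels_iff
        using st(2) f sorted_wrt_disjoint_words[of ?ts] unfolding w
        by (auto simp: increasing_distinct)
    qed (use len f gt lab in auto)
    then show ?thesis
      using w ws by (intro exI[of _ "Node m ?ts"]) simp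
  qed
qed

lemma bij_betw_word: "bij_betw word {t. gessel_tree M t} (stirling_perms M)"
  unfolding bij_betw_def
proof
  show "inj_on word {t. gessel_tree M t}"
    by (auto intro!: inj_onI word_inject simp: gessel_tree_iff)
  have S: "stirling_perms M = {\<sigma>. mset \<sigma> = M \<and> stirling \<sigma>}"
    by (simp add: stirling_perms_def stirling_def)
  show "word ` {t. gessel_tree M t} = stirling_perms M"
    unfolding S gessel_tree_iff using word_surj stirling_word by blast
qed

lemma finite_gessel_trees: "finite {t. gessel_tree M t}"
proof -
  have "finite {\<sigma>. mset \<sigma> = M}"
    by (metis ex_mset mset_eq_finite)
  then have "finite (stirling_perms M)"
    by (rule rev_finite_subset) (auto simp: stirling_perms_def)
  then show ?thesis
    using bij_betw_finite[OF bij_betw_word] by blast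
qed

section \<open>The weight of a permutation and of its tree\<close>

definition step_weight :: "'a \<Rightarrow> 'a \<Rightarrow> 'a \<Rightarrow> nat \<Rightarrow> nat \<Rightarrow> 'a" where
  "step_weight x y z p q = (if p < q then x else if p > q then y else z)"

text \<open>Taking a product over adjacent pairs, instead of counting the three kinds of indices, turns cutting
  a word at a letter into factorisation (\<open>path_weight_append\<close>).\<close>

fun path_weight :: "'a :: comm_semiring_1 \<Rightarrow> 'a \<Rightarrow> 'a \<Rightarrow> nat list \<Rightarrow> 'a" where
  "path_weight x y z (p # q # \<sigma>) = step_weight x y z p q * path_weight x y z (q # \<sigma>)"
| "path_weight x y z \<sigma> = 1"

lemma path_weight_append:
  "path_weight x y z (u @ m # v) = path_weight x y z (u @ [m]) * path_weight x y z (m # v)"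
proof (induction u)
  case (Cons p u)
  then show ?case by (cases u) (simp_all add: mult.assoc)
qed simp

lemma path_weight_conv_prod:
  "path_weight x y z \<sigma> = (\<Prod>i<length \<sigma> - 1. step_weight x y z (\<sigma> ! i) (\<sigma> ! Suc i))"
proof (induction x y z \<sigma> rule: path_weight.induct)
  case (1 x y z p q \<sigma>)
  then show ?case by (simp add: prod.lessThan_Suc_shift del: prod.lessThan_Suc)
qed simp_all

lemma prod_step_weight:
  assumes "finite A"
  shows "(\<Prod>i\<in>A. step_weight x y z (f i) (g i)) =
    (x :: 'a :: comm_semiring_1) ^ card {i\<in>A. f i < g i} *
      y ^ card {i\<in>A. f i > g i} * z ^ card {i\<in>A. f i = g i}"
  using assms
proof (induction A rule: finite_induct)
  case (insert a A)
  have ins: "{i \<in> insert a A. P i} = (if P a then insert a {i\<in>A. P i} else {i\<in>A. P i})" for P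
    by auto
  have "a \<notin> {i\<in>A. P i}" "finite {i\<in>A. P i}" for P using insert.hyps by auto
  then show ?case
    unfolding ins using insert
    by (auto simp: step_weight_def card_insert_disjoint mult_ac)
qed simp

text \<open>The three statistics range over \<open>1, \<dots>, K\<close>, where an index of \<open>asc\<close> stands for the pair to its
  left and an index of \<open>des\<close> or \<open>plat\<close> for the pair to its right. Thus \<open>asc\<close> omits the last of
  the \<open>K + 1\<close> adjacent pairs, and \<open>des\<close> and \<open>plat\<close> omit the first. The padding by \<open>0\<close> makes the
  first pair an ascent and the last one a descent, so nothing is lost.\<close>

lemma stirling_monomial_conv_path_weight:
  assumes "\<sigma> \<noteq> []" "0 \<notin> set \<sigma>"
  shows "(x :: 'a :: comm_semiring_1) ^ asc \<sigma> * y ^ des \<sigma> * z ^ plat \<sigma> =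
    path_weight x y z (padded \<sigma>)"
proof -
  let ?N = "length \<sigma>" and ?p = "padded \<sigma>"
  have first: "?p ! 0 = 0" and last: "?p ! Suc ?N = 0"
    by (simp_all add: padded_def nth_append)
  have second: "?p ! Suc 0 \<noteq> 0"
    using assms by (cases \<sigma>) (auto simp: padded_def)
  have "{i \<in> {1..?N}. ?p ! (i - 1) < ?p ! i} = Suc ` {i \<in> {..<Suc ?N}. ?p ! i < ?p ! Suc i}"
    (is "?A = Suc ` ?B")
  proof
    show "?A \<subseteq> Suc ` ?B"
    proof
      fix i assume "i \<in> ?A"
      then show "i \<in> Suc ` ?B" by (cases i) auto
    qed
    show "Suc ` ?B \<subseteq> ?A"
      using last by (auto simp: less_Suc_eq)
  qed
  then have "asc \<sigma> = card ?B"
    unfolding asc_def by (simp add: card_image)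
  moreover have "{i \<in> {1..?N}. ?p ! i > ?p ! (i + 1)} = {i \<in> {..<Suc ?N}. ?p ! i > ?p ! Suc i}"
    using first by (force simp: Suc_le_eq intro!: gr0I)
  moreover have "{i \<in> {1..?N}. ?p ! i = ?p ! (i + 1)} = {i \<in> {..<Suc ?N}. ?p ! i = ?p ! Suc i}"
    using first second by (force simp: Suc_le_eq intro!: gr0I)
  moreover have "length ?p - 1 = Suc ?N" by (simp add: padded_def)
  ultimately show ?thesis
    by (simp add: path_weight_conv_prod prod_step_weight des_def plat_def del: prod.lessThan_Suc)
qed

definition leaf_weight :: "'a \<Rightarrow> ptree \<Rightarrow> 'a :: comm_semiring_1" where
  "leaf_weight c t = (if t = Leaf then c else 1)"

definition middle_weight :: "'a \<Rightarrow> ptree list \<Rightarrow> 'a :: comm_semiring_1" where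
  "middle_weight z ts = prod_list (map (leaf_weight z) (butlast (tl ts)))"

definition vertex_weight :: "'a \<Rightarrow> 'a \<Rightarrow> 'a \<Rightarrow> ptree list \<Rightarrow> 'a :: comm_semiring_1" where
  "vertex_weight x y z ts = leaf_weight x (hd ts) * leaf_weight y (last ts) * middle_weight z ts"

primrec tree_prod :: "(ptree list \<Rightarrow> 'a) \<Rightarrow> ptree \<Rightarrow> 'a :: comm_semiring_1" where
  "tree_prod f Leaf = 1"
| "tree_prod f (Node a ts) = f ts * prod_list (map (tree_prod f) ts)"

abbreviation tree_weight :: "'a \<Rightarrow> 'a \<Rightarrow> 'a \<Rightarrow> ptree \<Rightarrow> 'a :: comm_semiring_1" where
  "tree_weight x y z \<equiv> tree_prod (vertex_weight x y z)"

lemma path_weight_join: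
  "path_weight x y z (p # join a (map word (s # us @ [e])) @ [q]) =
     path_weight x y z (p # word s @ [a]) *
     prod_list (map (\<lambda>u. path_weight x y z (a # word u @ [a])) us) *
     path_weight x y z (a # word e @ [q])"
proof (induction us arbitrary: p s)
  case Nil
  show ?case using path_weight_append[of x y z "p # word s" a "word e @ [q]"] by simp
next
  case (Cons u us)
  show ?case
    using path_weight_append[of x y z "p # word s" a "join a (map word (u # us @ [e])) @ [q]"]
      Cons.IH[of a u] by (simp add: mult.assoc)
qed

text \<open>Around the words of the children of \<open>a\<close>, the boundary letters are \<open>(p, a)\<close>, then \<open>(a, a)\<close>, and
  finally \<open>(a, q)\<close>, so that an empty word counts as an ascent, a plateau or a descent according to
  the position of the leaf. Since \<open>a\<close> exceeds \<open>p\<close> and \<open>q\<close>, the result depends on these two letters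
  only if the tree is a leaf.\<close>

lemma path_weight_word:
  assumes "increasing t" "\<And>b. b \<in> set (labels t) \<Longrightarrow> p < b \<and> q < b"
  shows "path_weight x y z (p # word t @ [q]) =
    leaf_weight (step_weight x y z p q) t * tree_weight x y z t"
  using assms
proof (induction arbitrary: p q rule: increasing.induct)
  case increasing_Leaf
  show ?case by (simp add: leaf_weight_def)
next
  case (increasing_Node ts a)
  obtain s us e where ts: "ts = s # us @ [e]"
    using two_ends[OF increasing_Node.hyps(1)] by blast
  have pa: "p < a" "q < a" using increasing_Node.prems by auto
  have IH: "path_weight x y z (p' # word t @ [q']) =
      leaf_weight (step_weight x y z p' q') t * tree_weight x y z t"
    if "t \<in> set ts" "p' \<le> a" "q' \<le> a" for t p' q'
    using increasing_Node.IH[OF that(1), of p' q'] increasing_Node.hyps(3)[OF that(1)] that(2,3)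
    by (meson le_less_trans)
  have "prod_list (map (\<lambda>u. path_weight x y z (a # word u @ [a])) vs) =
      prod_list (map (leaf_weight z) vs) * prod_list (map (tree_weight x y z) vs)"
    if "set vs \<subseteq> set ts" for vs
    using that by (induction vs) (simp_all add: IH step_weight_def mult_ac)
  then have "prod_list (map (\<lambda>u. path_weight x y z (a # word u @ [a])) us) =
      prod_list (map (leaf_weight z) us) * prod_list (map (tree_weight x y z) us)"
    by (simp add: ts subset_insertI2)
  then have "path_weight x y z (p # word (Node a ts) @ [q]) =
      (leaf_weight x s * leaf_weight y e * prod_list (map (leaf_weight z) us)) *
      prod_list (map (tree_weight x y z) ts)"
    using path_weight_join[of x y z p a s us e q] pa
    by (auto simp: ts IH step_weight_def mult_ac)
  also have "leaf_weight x s * leaf_weight y e * prod_list (map (leaf_weight z) us) =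
      vertex_weight x y z ts"
    by (simp add: vertex_weight_def middle_weight_def ts)
  finally show ?case by (simp add: leaf_weight_def)
qed

lemma stirling_poly_conv_trees:
  assumes "M \<noteq> {#}" "0 \<notin># M"
  shows "stirling_poly M x y z = (\<Sum>t | gessel_tree M t. tree_weight x y z t)"
proof -
  have "x ^ asc (word t) * y ^ des (word t) * z ^ plat (word t) = tree_weight x y z t"
    if "gessel_tree M t" for t
  proof -
    have inc: "increasing t" and M: "mset (word t) = M"
      using that by (auto simp: gessel_tree_iff)
    have ne: "word t \<noteq> []" "0 \<notin> set (word t)"
      using assms M by (metis mset.simps(1), metis set_mset_mset)
    then have "t \<noteq> Leaf" by auto
    moreover have "0 < b" if "b \<in> set (labels t)" for b
      using that ne(2) increasing_set_word[OF inc] by (metis gr0I)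
    ultimately show ?thesis
      using path_weight_word[OF inc, of 0 0 x y z]
      by (simp add: stirling_monomial_conv_path_weight[OF ne] padded_def leaf_weight_def)
  qed
  then show ?thesis
    unfolding stirling_poly_def
    by (subst sum.reindex_bij_betw[OF bij_betw_word, symmetric]) simp
qed

section \<open>Moving leaves to the front\<close>

definition swap_ends :: "ptree list \<Rightarrow> ptree list" where
  "swap_ends ts = last ts # butlast (tl ts) @ [hd ts]"

text \<open>The length condition makes the first and the last child two different positions, so that
  \<open>swap_ends\<close> is a permutation of the list.\<close>

definition unbalanced_last :: "ptree list \<Rightarrow> bool" where
  "unbalanced_last ts \<longleftrightarrow> 2 \<le> length ts \<and> last ts = Leaf \<and> hd ts \<noteq> Leaf"

definition settle :: "ptree list \<Rightarrow> ptree list" where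
  "settle ts = (if unbalanced_last ts then swap_ends ts else ts)"

primrec canon :: "ptree \<Rightarrow> ptree" where
  "canon Leaf = Leaf"
| "canon (Node a ts) = Node a (settle (map canon ts))"

lemma mset_settle [simp]: "mset (settle ts) = mset ts"
proof (cases "unbalanced_last ts")
  case True
  then obtain s us e where "ts = s # us @ [e]"
    using two_ends unfolding unbalanced_last_def by blast
  then show ?thesis by (simp add: settle_def swap_ends_def)
qed (simp add: settle_def)

lemma length_settle [simp]: "length (settle ts) = length ts"
  by (metis mset_settle size_mset)

lemma set_settle [simp]: "set (settle ts) = set ts"
  by (metis mset_settle set_mset_mset)

lemma canon_eq_Leaf_iff [simp]: "canon t = Leaf \<longleftrightarrow> t = Leaf"
  by (cases t) auto

lemma mset_concat_cong: "mset xs = mset ys \<Longrightarrow> mset (concat (map f xs)) = mset (concat (map f ys))"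
  by (metis mset_concat mset_map sum_mset_sum_list map_map)

lemma mset_labels_canon: "mset (labels (canon t)) = mset (labels t)"
proof (induction t)
  case (Node a ts)
  have "mset (concat (map labels (settle (map canon ts)))) = mset (concat (map labels (map canon ts)))"
    by (rule mset_concat_cong) simp
  also have "\<dots> = mset (concat (map labels ts))"
    using Node by (simp add: mset_concat o_def cong: map_cong)
  finally show ?case by simp
qed simp

lemma canon_Node_mem_iff:
  "(\<exists>us. Node b us \<in> canon ` set ts) \<longleftrightarrow> (\<exists>us. Node b us \<in> set ts)"
proof
  assume "\<exists>us. Node b us \<in> canon ` set ts"
  then obtain us t where t: "t \<in> set ts" "Node b us = canon t" by blast
  from t(2) obtain vs where "t = Node b vs" by (cases t) auto
  then show "\<exists>us. Node b us \<in> set ts" using t(1) by blast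
next
  assume "\<exists>us. Node b us \<in> set ts"
  then obtain us where "canon (Node b us) \<in> canon ` set ts" by blast
  then show "\<exists>us. Node b us \<in> canon ` set ts" by auto
qed

text \<open>Rearranging children changes neither labels, nor numbers of children, nor who is whose parent.\<close>

lemma gessel_tree_canon_iff: "gessel_tree M (canon t) \<longleftrightarrow> gessel_tree M t"
proof -
  define Q where "Q = (\<lambda>(a, ts). length ts = count M a + 1 \<and> (\<forall>b us. Node b us \<in> set ts \<longrightarrow> a < b))"
  have g: "gessel_tree M t \<longleftrightarrow> distinct (labels t) \<and> set (labels t) = set_mset M \<and>
      (\<forall>v\<in>set (vertices t). Q v)" for t
    by (fastforce simp: gessel_tree_def labels_def Q_def)
  have "(\<forall>v\<in>set (vertices (canon t)). Q v) \<longleftrightarrow> (\<forall>v\<in>set (vertices t). Q v)"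
  proof (induction t)
    case (Node a ts)
    have "Q (a, settle (map canon ts)) \<longleftrightarrow> Q (a, ts)"
      by (simp add: Q_def canon_Node_mem_iff)
    then show ?case using Node by (simp add: ball_UN)
  qed simp
  moreover have "distinct (labels (canon t)) \<longleftrightarrow> distinct (labels t)"
    using mset_labels_canon by (metis mset_eq_imp_distinct_iff)
  moreover have "set (labels (canon t)) = set (labels t)"
    using mset_labels_canon by (metis set_mset_mset)
  ultimately show ?thesis by (simp add: g)
qed

text \<open>Choosing a preimage of a list is choosing a preimage of each of its entries independently.\<close>

lemma sum_prod_list_fibre:
  fixes w :: "'b \<Rightarrow> 'a :: comm_semiring_1"
  assumes "\<And>c. c \<in> set cs \<Longrightarrow> finite {t. g t = c}"
  shows "finite {ts. map g ts = cs} \<and>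
    (\<Sum>ts | map g ts = cs. prod_list (map w ts)) = prod_list (map (\<lambda>c. \<Sum>t | g t = c. w t) cs)"
  using assms
proof (induction cs)
  case (Cons c cs)
  have eq: "{ts. map g ts = c # cs} = (\<lambda>(t, ts). t # ts) ` ({t. g t = c} \<times> {ts. map g ts = cs})"
    by (auto simp: map_eq_Cons_conv)
  have inj: "inj_on (\<lambda>(t, ts). t # ts) ({t. g t = c} \<times> {ts. map g ts = cs})"
    by (auto intro: inj_onI)
  have fin: "finite {t. g t = c}" "finite {ts. map g ts = cs}"
    using Cons by auto
  have "(\<Sum>(t, ts)\<in>{t. g t = c} \<times> {ts. map g ts = cs}. w t * prod_list (map w ts)) =
      (\<Sum>t | g t = c. w t) * (\<Sum>ts | map g ts = cs. prod_list (map w ts))"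
    by (simp add: sum_product sum.cartesian_product)
  then show ?case
    unfolding eq sum.reindex[OF inj] using Cons fin
    by (simp add: split_def o_def)
qed simp

definition first_leaves :: "ptree list \<Rightarrow> nat" where
  "first_leaves ts = (if hd ts = Leaf then 1 else 0)"

definition last_leaves :: "ptree list \<Rightarrow> nat" where
  "last_leaves ts = (if last ts = Leaf then 1 else 0)"

text \<open>The sum of \<open>vertex_weight\<close> over the arrangements of the children that \<open>settle\<close> sends to \<open>ts\<close>,
  for \<open>ts\<close> among the values of \<open>settle\<close>. The truncated difference is \<open>1\<close> exactly if the first child
  is a leaf and the last is not.\<close>

definition orbit_vertex_weight :: "'a \<Rightarrow> 'a \<Rightarrow> 'a \<Rightarrow> ptree list \<Rightarrow> 'a :: comm_semiring_1" where
  "orbit_vertex_weight x y z ts = (x * y) ^ last_leaves ts *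
     (x + y) ^ (first_leaves ts - last_leaves ts) * middle_weight z ts"

lemma leaf_weight_canon [simp]: "leaf_weight c (canon t) = leaf_weight c t"
  by (simp add: leaf_weight_def)

lemma vertex_weight_map_canon:
  assumes "2 \<le> length ts"
  shows "vertex_weight x y z (map canon ts) = vertex_weight x y z ts"
proof -
  obtain s us e where "ts = s # us @ [e]" using two_ends[OF assms] by blast
  then show ?thesis
    by (simp add: vertex_weight_def middle_weight_def o_def)
qed

text \<open>For trees whose vertices have at least two children, this is canonicity (\<open>settled_iff_canonical\<close>),
  in a form that passes to subtrees.\<close>

definition settled :: "ptree \<Rightarrow> bool" where
  "settled t \<longleftrightarrow> (\<forall>(a, ts)\<in>set (vertices t). 2 \<le> length ts \<and> \<not> unbalanced_last ts)"

text \<open>A list of children is sent to \<open>cs\<close> if the children's canonical forms are \<open>cs\<close> itself or, in case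
  only the first entry of \<open>cs\<close> is a leaf, \<open>cs\<close> with its ends exchanged. The choices inside the
  children contribute the same product to both cases, and the factors \<open>x\<close> and \<open>y\<close> of the one leaf
  at an end add up.\<close>

lemma sum_fibre_canon:
  assumes "settled c"
  shows "finite {t. canon t = c} \<and>
    (\<Sum>t | canon t = c. tree_weight x y z t) = tree_prod (orbit_vertex_weight x y z) c"
  using assms
proof (induction c)
  case Leaf
  have "{t. canon t = Leaf} = {Leaf}" by auto
  then show ?case by simp
next
  case (Node a cs)
  let ?F = "\<lambda>cs. {ts. map canon ts = cs}"
  have len: "2 \<le> length cs" and bal: "\<not> unbalanced_last cs"
    using Node.prems by (auto simp: settled_def)
  obtain s us e where cs: "cs = s # us @ [e]" using two_ends[OF len] by blast
  have IH: "finite {t. canon t = c}"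
      "(\<Sum>t | canon t = c. tree_weight x y z t) = tree_prod (orbit_vertex_weight x y z) c"
    if "c \<in> set cs" for c
    using Node.IH[OF that] Node.prems that by (auto simp: settled_def)
  have F: "finite (?F ds) \<and> (\<Sum>ts\<in>?F ds. tree_weight x y z (Node a ts)) =
      vertex_weight x y z ds * prod_list (map (tree_prod (orbit_vertex_weight x y z)) cs)"
    if "mset ds = mset cs" for ds
  proof -
    have set: "set ds = set cs" and len': "length ds = length cs"
      using that by (metis set_mset_mset, metis size_mset)
    have *: "finite (?F ds)" "(\<Sum>ts\<in>?F ds. prod_list (map (tree_weight x y z) ts)) =
        prod_list (map (\<lambda>c. \<Sum>t | canon t = c. tree_weight x y z t) ds)"
      using sum_prod_list_fibre[of ds canon "tree_weight x y z"] IH(1) set by auto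
    have "(\<Sum>ts\<in>?F ds. tree_weight x y z (Node a ts)) =
        (\<Sum>ts\<in>?F ds. vertex_weight x y z ds * prod_list (map (tree_weight x y z) ts))"
    proof (rule sum.cong)
      fix ts assume "ts \<in> ?F ds"
      then have "2 \<le> length ts" "map canon ts = ds"
        using len by (auto simp flip: len')
      then show "tree_weight x y z (Node a ts) =
          vertex_weight x y z ds * prod_list (map (tree_weight x y z) ts)"
        using vertex_weight_map_canon[of ts x y z] by simp
    qed simp
    also have "\<dots> = vertex_weight x y z ds *
        prod_list (map (\<lambda>c. \<Sum>t | canon t = c. tree_weight x y z t) ds)"
      by (simp add: *(2) flip: sum_distrib_left)
    also have "map (\<lambda>c. \<Sum>t | canon t = c. tree_weight x y z t) ds =
        map (tree_prod (orbit_vertex_weight x y z)) ds"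
      using IH(2) set by (intro map_cong) auto
    also have "prod_list (map (tree_prod (orbit_vertex_weight x y z)) ds) =
        prod_list (map (tree_prod (orbit_vertex_weight x y z)) cs)"
      using that by (metis mset_map prod_mset_prod_list)
    finally show ?thesis using *(1) by simp
  qed
  have settle: "settle ds = cs \<longleftrightarrow> ds = cs \<or> s = Leaf \<and> e \<noteq> Leaf \<and> ds = swap_ends cs" for ds
  proof (cases "unbalanced_last ds")
    case True
    then obtain s' us' e' where "ds = s' # us' @ [e']"
      using two_ends unfolding unbalanced_last_def by blast
    with True show ?thesis
      using bal by (auto simp: settle_def swap_ends_def unbalanced_last_def cs)
  next
    case False
    then show ?thesis
      by (auto simp: settle_def unbalanced_last_def swap_ends_def cs)
  qed
  have inj: "inj_on (Node a) A" for A by (auto intro: inj_onI)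
  show ?case
  proof (cases "s = Leaf \<and> e \<noteq> Leaf")
    case True
    have "canon t = Node a cs \<longleftrightarrow> t \<in> Node a ` (?F cs \<union> ?F (swap_ends cs))" for t
      using True by (cases t) (auto simp: settle)
    then have eq: "{t. canon t = Node a cs} = Node a ` (?F cs \<union> ?F (swap_ends cs))" by blast
    have sw: "mset (swap_ends cs) = mset cs" by (simp add: swap_ends_def cs)
    have disj: "?F cs \<inter> ?F (swap_ends cs) = {}"
      using True by (auto simp: swap_ends_def cs)
    have "vertex_weight x y z cs + vertex_weight x y z (swap_ends cs) = orbit_vertex_weight x y z cs"
      using True by (simp add: cs swap_ends_def vertex_weight_def orbit_vertex_weight_def
        middle_weight_def leaf_weight_def first_leaves_def last_leaves_def algebra_simps)
    then show ?thesis
      using F[OF refl] F[OF sw] disj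
      by (simp add: eq sum.reindex[OF inj] sum.union_disjoint o_def flip: distrib_right del: tree_prod.simps(2))
        simp
  next
    case False
    have "canon t = Node a cs \<longleftrightarrow> t \<in> Node a ` ?F cs" for t
      using False by (cases t) (auto simp: settle)
    then have eq: "{t. canon t = Node a cs} = Node a ` ?F cs" by blast
    have "s = Leaf \<longleftrightarrow> e = Leaf"
      using False bal by (auto simp: unbalanced_last_def cs)
    then have "vertex_weight x y z cs = orbit_vertex_weight x y z cs"
      by (simp add: cs vertex_weight_def orbit_vertex_weight_def
        middle_weight_def leaf_weight_def first_leaves_def last_leaves_def)
    then show ?thesis
      using F[OF refl]
      by (simp add: eq sum.reindex[OF inj] o_def finite_imageI del: tree_prod.simps(2)) simp
  qed
qed

section \<open>Counting the leaves of canonical trees\<close>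

primrec tree_sum :: "(ptree list \<Rightarrow> nat) \<Rightarrow> ptree \<Rightarrow> nat" where
  "tree_sum h Leaf = 0"
| "tree_sum h (Node a ts) = h ts + sum_list (map (tree_sum h) ts)"

definition middle_leaves :: "ptree list \<Rightarrow> nat" where
  "middle_leaves ts = length (filter (\<lambda>t. t = Leaf) (butlast (tl ts)))"

lemma tree_sum_cong:
  assumes "\<And>a ts. (a, ts) \<in> set (vertices t) \<Longrightarrow> g ts = h ts"
  shows "tree_sum g t = tree_sum h t"
  using assms
proof (induction t)
  case (Node a ts)
  have "tree_sum g t = tree_sum h t" if "t \<in> set ts" for t
    using Node.IH[OF that] Node.prems that by auto
  then have "map (tree_sum g) ts = map (tree_sum h) ts" by simp
  then show ?case using Node.prems[of a ts] by (simp del: map_eq_conv)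
qed simp

definition vertex_leaves :: "ptree list \<Rightarrow> (ptree list \<times> nat) list" where
  "vertex_leaves ts = [(ts, p). p \<leftarrow> [0..<length ts], ts ! p = Leaf]"

lemma leaves_simps [simp]:
  "leaves Leaf = []"
  "leaves (Node a ts) = vertex_leaves ts @ concat (map leaves ts)"
proof -
  have "concat (map g (concat xss)) = concat (map (\<lambda>xs. concat (map g xs)) xss)"
    for g :: "nat \<times> ptree list \<Rightarrow> (ptree list \<times> nat) list" and xss
    by (induction xss) auto
  then show "leaves Leaf = []" "leaves (Node a ts) = vertex_leaves ts @ concat (map leaves ts)"
    by (simp_all add: leaves_def[abs_def] vertex_leaves_def o_def)
qed

lemma length_filter_leaves:
  "length (filter P (leaves t)) = tree_sum (\<lambda>ts. length (filter P (vertex_leaves ts))) t"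
proof (induction t)
  case (Node a ts)
  then show ?case
    by (simp add: filter_concat length_concat o_def cong: map_cong)
qed simp

lemma length_filter_vertex_leaves:
  "length (filter P (vertex_leaves ts)) =
     length (filter (\<lambda>p. ts ! p = Leaf \<and> P (ts, p)) [0..<length ts])"
proof -
  have "length (filter P (concat (map (\<lambda>p. if Q p then [f p] else []) ps))) =
      length (filter (\<lambda>p. Q p \<and> P (f p)) ps)" for Q f and ps :: "nat list"
    by (induction ps) auto
  then show ?thesis by (simp add: vertex_leaves_def)
qed

lemma upt_two_ends: "[0..<length (s # us @ [e])] = 0 # map Suc [0..<length us] @ [Suc (length us)]"
proof -
  have "[0..<Suc (Suc n)] = 0 # map Suc [0..<Suc n]" for n
    unfolding map_Suc_upt by (rule upt_conv_Cons) simp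
  then show ?thesis by simp
qed

lemma y_leaves_at_vertex:
  assumes "2 \<le> length ts"
  shows "length (filter y_leaf (vertex_leaves ts)) = last_leaves ts"
proof -
  obtain s us e where ts: "ts = s # us @ [e]" using two_ends[OF assms] by blast
  show ?thesis
    unfolding length_filter_vertex_leaves unfolding ts upt_two_ends
    by (simp add: y_leaf_def last_leaves_def filter_map o_def nth_append)
qed

lemma z_leaves_at_vertex:
  assumes "2 \<le> length ts"
  shows "length (filter z_leaf (vertex_leaves ts)) = middle_leaves ts"
proof -
  obtain s us e where ts: "ts = s # us @ [e]" using two_ends[OF assms] by blast
  have "filter (\<lambda>p. (us @ [e]) ! p = Leaf \<and> p \<noteq> length us) [0..<length us] =
      filter (\<lambda>p. us ! p = Leaf) [0..<length us]"
    by (rule filter_cong) (auto simp: nth_append)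
  moreover have "length (filter (\<lambda>p. us ! p = Leaf) [0..<length us]) =
      length (filter (\<lambda>t. t = Leaf) (map ((!) us) [0..<length us]))"
    by (simp only: filter_map length_map o_def)
  ultimately show ?thesis
    unfolding length_filter_vertex_leaves unfolding ts upt_two_ends
    by (simp add: z_leaf_def x_leaf_def y_leaf_def middle_leaves_def filter_map o_def map_nth)
qed

lemma y_leaves_conv_tree_sum: "increasing t \<Longrightarrow> y_leaves t = tree_sum last_leaves t"
  unfolding y_leaves_def length_filter_leaves
  by (intro tree_sum_cong y_leaves_at_vertex) (rule increasing_length)

lemma z_leaves_conv_tree_sum: "increasing t \<Longrightarrow> z_leaves t = tree_sum middle_leaves t"
  unfolding z_leaves_def length_filter_leaves
  by (intro tree_sum_cong z_leaves_at_vertex) (rule increasing_length)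

lemma set_leaves:
  "set (leaves t) =
    {(ts, p). (\<exists>a. (a, ts) \<in> set (vertices t)) \<and> p < length ts \<and> ts ! p = Leaf}"
  by (force simp: leaves_def)

lemma settled_iff_canonical:
  assumes "\<And>a ts. (a, ts) \<in> set (vertices t) \<Longrightarrow> 2 \<le> length ts"
  shows "settled t \<longleftrightarrow> canonical t"
proof -
  have "\<not> unbalanced_last ts \<longleftrightarrow>
      (\<forall>p<length ts. ts ! p = Leaf \<longrightarrow> y_leaf (ts, p) \<longrightarrow> balanced (ts, p))"
    if len: "2 \<le> length ts" for ts
  proof -
    obtain s us e where ts: "ts = s # us @ [e]" using two_ends[OF len] by blast
    show ?thesis
      by (auto simp: ts unbalanced_last_def y_leaf_def balanced_def x_leaf_def)
  qed
  then show ?thesis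
    using assms unfolding settled_def canonical_def set_leaves by fast
qed

lemma settled_canon:
  assumes "\<And>a ts. (a, ts) \<in> set (vertices t) \<Longrightarrow> 2 \<le> length ts"
  shows "settled (canon t)"
  using assms
proof (induction t)
  case (Node a ts)
  have "settled (canon t)" if "t \<in> set ts" for t
    using Node.IH[OF that] Node.prems that by auto
  moreover have "2 \<le> length ts" using Node.prems[of a ts] by simp
  moreover have "\<not> unbalanced_last (settle us)" for us
    by (auto simp: settle_def unbalanced_last_def swap_ends_def)
  ultimately show ?case by (fastforce simp: settled_def)
qed (simp add: settled_def)

lemma middle_weight_conv: "middle_weight z ts = z ^ middle_leaves ts"
proof -
  have "prod_list (map (leaf_weight z) us) = z ^ length (filter (\<lambda>t. t = Leaf) us)" for us
    by (induction us) (auto simp: leaf_weight_def)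
  then show ?thesis by (simp add: middle_weight_def middle_leaves_def)
qed

lemma tree_prod_mult: "tree_prod (\<lambda>ts. f ts * g ts) t = tree_prod f t * tree_prod g t"
proof (induction t)
  case (Node a ts)
  have "prod_list (map (tree_prod (\<lambda>ts. f ts * g ts)) us) =
      prod_list (map (tree_prod f) us) * prod_list (map (tree_prod g) us)" if "set us \<subseteq> set ts" for us
    using that by (induction us) (auto simp: Node.IH mult_ac)
  then show ?case by (simp add: mult_ac)
qed simp

lemma tree_prod_power: "tree_prod (\<lambda>ts. c ^ h ts) t = c ^ tree_sum h t"
proof (induction t)
  case (Node a ts)
  have "prod_list (map (tree_prod (\<lambda>ts. c ^ h ts)) us) = c ^ sum_list (map (tree_sum h) us)"
    if "set us \<subseteq> set ts" for us
    using that by (induction us) (auto simp: Node.IH power_add)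
  then show ?case by (simp add: power_add)
qed simp

lemma length_word_Node:
  "length (word (Node a ts)) = length ts - 1 + (\<Sum>t\<leftarrow>ts. length (word t))"
proof -
  have "length (join a ws) = length ws - 1 + sum_list (map length ws)" for ws
    by (metis mset_join length_concat size_mset size_replicate_mset size_union)
  then show ?thesis by (simp add: o_def)
qed

lemma middle_leaves_le: "2 \<le> length ts \<Longrightarrow> middle_leaves ts + 1 \<le> length ts - 1"
  using length_filter_le[of "\<lambda>t. t = Leaf" "butlast (tl ts)"] by (simp add: middle_leaves_def)

text \<open>Of the \<open>k + 1\<close> children of a vertex, at most \<open>k - 1\<close> are middle leaves.\<close>

lemma z_leaves_bound:
  "increasing t \<Longrightarrow> tree_sum middle_leaves t + length (labels t) \<le> length (word t)"
proof (induction rule: increasing.induct)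
  case (increasing_Node ts a)
  have "(\<Sum>t\<leftarrow>ts. tree_sum middle_leaves t + length (labels t)) \<le> (\<Sum>t\<leftarrow>ts. length (word t))"
    using increasing_Node.IH by (intro sum_list_mono) auto
  then show ?case
    using middle_leaves_le[OF increasing_Node.hyps(1)]
    unfolding length_word_Node by (simp add: sum_list_addf length_concat o_def)
qed simp

text \<open>Descending from the root through last children ends at a last leaf.\<close>

lemma y_leaves_pos: "increasing t \<Longrightarrow> t \<noteq> Leaf \<Longrightarrow> 1 \<le> tree_sum last_leaves t"
proof (induction rule: increasing.induct)
  case (increasing_Node ts a)
  show ?case
  proof (cases "last ts = Leaf")
    case True
    then show ?thesis by (simp add: last_leaves_def)
  next
    case False
    have l: "last ts \<in> set ts" using increasing_Node.hyps(1) by (intro last_in_set) auto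
    have "tree_sum last_leaves (last ts) \<le> sum_list (map (tree_sum last_leaves) ts)"
      using l by (intro member_le_sum_list) auto
    then show ?thesis using increasing_Node.IH[OF l False] by simp
  qed
qed simp

text \<open>The left-hand side is the number of leaves: by canonicity, each last leaf comes with a first leaf.
  It exceeds the length of the word by \<open>1\<close>, because replacing a leaf by a vertex with \<open>k + 1\<close> leaves
  adds \<open>k\<close> to both numbers. The indicator accounts for a single leaf, which has no parent.\<close>

lemma leaf_count:
  assumes "settled t"
  shows "tree_sum (\<lambda>ts. first_leaves ts - last_leaves ts) t + 2 * tree_sum last_leaves t +
    tree_sum middle_leaves t + of_bool (t = Leaf) = length (word t) + 1"
  using assms
proof (induction t)
  case (Node a ts)
  let ?d = "\<lambda>ts. first_leaves ts - last_leaves ts"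
  let ?S = "\<lambda>t. tree_sum ?d t + 2 * tree_sum last_leaves t + tree_sum middle_leaves t"
  have len: "2 \<le> length ts" and bal: "\<not> unbalanced_last ts"
    using Node.prems by (auto simp: settled_def)
  obtain s us e where ts: "ts = s # us @ [e]" using two_ends[OF len] by blast
  have "length (filter (\<lambda>t. t = Leaf) us) = (\<Sum>t\<leftarrow>us. of_bool (t = Leaf))" for us
    by (induction us) auto
  then have loc: "?d ts + 2 * last_leaves ts + middle_leaves ts = (\<Sum>t\<leftarrow>ts. of_bool (t = Leaf))"
    using bal len
    by (auto simp: ts first_leaves_def last_leaves_def middle_leaves_def unbalanced_last_def)
  have "?S t + of_bool (t = Leaf) = length (word t) + 1" if "t \<in> set ts" for t
    using Node.IH[OF that] Node.prems that by (auto simp: settled_def)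
  then have "(\<Sum>t\<leftarrow>ts. ?S t + of_bool (t = Leaf)) = (\<Sum>t\<leftarrow>ts. length (word t) + 1)"
    by (intro arg_cong[of _ _ sum_list] map_cong) auto
  then have "sum_list (map (tree_sum ?d) ts) + 2 * sum_list (map (tree_sum last_leaves) ts) +
      sum_list (map (tree_sum middle_leaves) ts) + (\<Sum>t\<leftarrow>ts. of_bool (t = Leaf)) =
      (\<Sum>t\<leftarrow>ts. length (word t)) + length ts"
    by (simp add: sum_list_addf sum_list_const_mult sum_list_Suc)
  then show ?case
    using loc len unfolding length_word_Node by (simp add: algebra_simps)
qed simp

text \<open>The two bounds place every canonical tree inside the ranges of the double sum, so that grouping
  the trees by their numbers of leaves loses none of them.\<close>

lemma tree_prod_orbit_vertex_weight:
  assumes "gessel_tree M t" "canonical t" "M \<noteq> {#}"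
  shows "tree_prod (orbit_vertex_weight x y z) t =
      z ^ z_leaves t * ((x * y) ^ y_leaves t * (x + y) ^ (size M + 1 - z_leaves t - 2 * y_leaves t))"
    and "z_leaves t \<le> size M - card (set_mset M)"
    and "y_leaves t \<in> {1..(size M + 1 - z_leaves t) div 2}"
proof -
  have inc: "increasing t" and M: "mset (word t) = M"
    using assms(1) by (auto simp: gessel_tree_iff)
  have nl: "t \<noteq> Leaf" using M assms(3) by auto
  have len: "length (word t) = size M" using M by auto
  have "settled t" using assms(2) settled_iff_canonical increasing_length[OF inc] by blast
  note c = leaf_count[OF this, folded y_leaves_conv_tree_sum[OF inc] z_leaves_conv_tree_sum[OF inc]]
  then have d: "tree_sum (\<lambda>ts. first_leaves ts - last_leaves ts) t =
      size M + 1 - z_leaves t - 2 * y_leaves t"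
    using nl len by simp
  show "tree_prod (orbit_vertex_weight x y z) t =
      z ^ z_leaves t * ((x * y) ^ y_leaves t * (x + y) ^ (size M + 1 - z_leaves t - 2 * y_leaves t))"
    unfolding orbit_vertex_weight_def middle_weight_conv tree_prod_mult tree_prod_power
      d y_leaves_conv_tree_sum[OF inc, symmetric] z_leaves_conv_tree_sum[OF inc, symmetric]
    by (simp add: mult_ac)
  have "length (labels t) = card (set_mset M)"
    using increasing_distinct[OF inc] increasing_set_word[OF inc] M
    by (metis distinct_card set_mset_mset)
  then show "z_leaves t \<le> size M - card (set_mset M)"
    using z_leaves_bound[OF inc] len by (simp add: z_leaves_conv_tree_sum[OF inc])
  show "y_leaves t \<in> {1..(size M + 1 - z_leaves t) div 2}"
    using y_leaves_pos[OF inc nl] c nl len y_leaves_conv_tree_sum[OF inc] by auto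
qed

section \<open>The gamma expansion\<close>

lemma stirling_poly_conv_gamma:
  assumes "M \<noteq> {#}" "0 \<notin># M"
  shows "stirling_poly M x y z =
    (\<Sum>i=0..size M - card (set_mset M). z ^ i *
      (\<Sum>j=1..(size M + 1 - i) div 2.
        of_nat (gamma_coeff M i j) * (x * y) ^ j * (x + y) ^ (size M + 1 - i - 2 * j)))"
proof -
  let ?G = "{t. gessel_tree M t}" and ?C = "{t. gessel_tree M t \<and> canonical t}"
  let ?e = "\<lambda>i j. (x * y) ^ j * (x + y) ^ (size M + 1 - i - 2 * j)"
  have len: "2 \<le> length ts" if "gessel_tree M t" "(a, ts) \<in> set (vertices t)" for t a ts
    using that increasing_length by (auto simp: gessel_tree_iff)
  have finC: "finite ?C"
    by (rule finite_subset[OF _ finite_gessel_trees[of M]]) auto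
  have "canon ` ?G \<subseteq> ?C"
    using len settled_canon settled_iff_canonical gessel_tree_canon_iff
    by (smt (verit) image_subset_iff mem_Collect_eq)
  then have "(\<Sum>t\<in>?G. tree_weight x y z t) =
      (\<Sum>c\<in>?C. \<Sum>t | t \<in> ?G \<and> canon t = c. tree_weight x y z t)"
    by (intro sum.group[symmetric] finite_gessel_trees finC)
  also have "\<dots> = (\<Sum>c\<in>?C. tree_prod (orbit_vertex_weight x y z) c)"
  proof (rule sum.cong)
    fix c assume c: "c \<in> ?C"
    \<comment> \<open>The Gessel trees form a union of fibres, so no part of a fibre is cut off.\<close>
    then have "{t. t \<in> ?G \<and> canon t = c} = {t. canon t = c}"
      using gessel_tree_canon_iff by auto
    moreover have "settled c" using c len settled_iff_canonical by blast
    ultimately show "(\<Sum>t | t \<in> ?G \<and> canon t = c. tree_weight x y z t) =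
        tree_prod (orbit_vertex_weight x y z) c"
      using sum_fibre_canon by metis
  qed simp
  also have "\<dots> = (\<Sum>c\<in>?C. z ^ z_leaves c * ?e (z_leaves c) (y_leaves c))"
    using assms tree_prod_orbit_vertex_weight(1) by (intro sum.cong) auto
  also have "\<dots> = (\<Sum>i=0..size M - card (set_mset M). \<Sum>c | c \<in> ?C \<and> z_leaves c = i.
      z ^ z_leaves c * ?e (z_leaves c) (y_leaves c))"
    using assms tree_prod_orbit_vertex_weight(2)
    by (intro sum.group[symmetric] finC) auto
  also have "\<dots> = (\<Sum>i=0..size M - card (set_mset M). z ^ i *
      (\<Sum>j=1..(size M + 1 - i) div 2. of_nat (gamma_coeff M i j) * ?e i j))"
  proof (rule sum.cong)
    fix i
    let ?Ci = "{c. c \<in> ?C \<and> z_leaves c = i}"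
    have "(\<Sum>c\<in>?Ci. z ^ z_leaves c * ?e (z_leaves c) (y_leaves c)) =
        z ^ i * (\<Sum>c\<in>?Ci. ?e i (y_leaves c))"
      by (simp add: sum_distrib_left)
    also have "(\<Sum>c\<in>?Ci. ?e i (y_leaves c)) =
        (\<Sum>j=1..(size M + 1 - i) div 2. \<Sum>c | c \<in> ?Ci \<and> y_leaves c = j. ?e i (y_leaves c))"
      using assms tree_prod_orbit_vertex_weight(3)
      by (intro sum.group[symmetric] finite_subset[OF _ finC]) auto
    also have "\<dots> = (\<Sum>j=1..(size M + 1 - i) div 2. of_nat (gamma_coeff M i j) * ?e i j)"
    proof (rule sum.cong)
      fix j
      have "(\<Sum>c | c \<in> ?Ci \<and> y_leaves c = j. ?e i (y_leaves c)) =
          (\<Sum>c | c \<in> ?Ci \<and> y_leaves c = j. ?e i j)"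
        by (intro sum.cong) auto
      then show "(\<Sum>c | c \<in> ?Ci \<and> y_leaves c = j. ?e i (y_leaves c)) =
          of_nat (gamma_coeff M i j) * ?e i j"
        by (simp add: gamma_coeff_def conj_assoc)
    qed simp
    finally show "(\<Sum>c\<in>?Ci. z ^ z_leaves c * ?e (z_leaves c) (y_leaves c)) =
        z ^ i * (\<Sum>j=1..(size M + 1 - i) div 2. of_nat (gamma_coeff M i j) * ?e i j)" .
  qed simp
  finally show ?thesis
    using stirling_poly_conv_trees[OF assms, of x y z] by (simp add: mult.assoc)
qed

theorem theorem3p1:
  fixes n K :: nat and k :: "nat \<Rightarrow> nat" and M :: "nat multiset"
    and x y z :: "'a :: comm_semiring_1"
  assumes "n \<ge> 1"
    and "\<And>i. i \<in> {1..n} \<Longrightarrow> k i \<ge> 1"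
    and "M = (\<Sum>i=1..n. replicate_mset (k i) i)"
    and "K = (\<Sum>i=1..n. k i)"
  shows "stirling_poly M x y z =
    (\<Sum>i=0..K - n. z ^ i *
      (\<Sum>j=1..(K + 1 - i) div 2.
        of_nat (gamma_coeff M i j) * (x * y) ^ j * (x + y) ^ (K + 1 - i - 2 * j)))"
proof -
  have "set_mset M = (\<Union>i\<in>{1..n}. set_mset (replicate_mset (k i) i))"
    unfolding assms(3) by (rule set_mset_sum) simp
  also have "\<dots> = {1..n}" using assms(2) by fastforce
  finally have set: "set_mset M = {1..n}" .
  have "size M = K" unfolding assms(3,4) by simp
  moreover have "M \<noteq> {#}" "0 \<notin># M" using set assms(1) by auto
  ultimately show ?thesis
    using stirling_poly_conv_gamma[of M x y z] set by simp
qed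

end
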